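(* Let $n$ be a positive integer, let $r$ be an integer with $\gcd(r,n)=1$, and let $\varphi\colon\mathbb{Z}_n\to\mathbb{Z}_n$, $x\mapsto rx$, be the corresponding automorphism, of order $m$. Then $\varphi$ is a symmetric skew-morphism of $\mathbb{Z}_n$ if and only if $m\mid n$ and $r\equiv1\pmod{m}$.
   Context: A skew-morphism of a finite group $A$ is a bijection $\varphi\colon A\to A$ fixing the identity with a function $\pi\colon A\to\mathbb{Z}$ (power function) such that $\varphi(xy)=\varphi(x)\varphi^{\pi(x)}(y)$ for all $x,y$; every automorphism is a skew-morphism. A skew-morphism $\varphi$ of $\mathbb{Z}_n$ is symmetric if its order $|\varphi|$ divides $n$ and the function $\pi(x)=-\varphi^{-x}(-1)$ ($x\in\mathbb{Z}_n$) is a power function of $\varphi$. *)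

theory Defs
  imports "HOL-Algebra.Algebra" "HOL-Number_Theory.Cong"
begin

(* Permutations of the carrier are elements of the library's group BijGroup, so that
   integer (in particular negative) powers and the order of a permutation are the
   group-theoretic ones. Members of BijGroup are extensional: undefined off the carrier. *)

definition power_function ::
    "('a, 'b) monoid_scheme \<Rightarrow> ('a \<Rightarrow> 'a) \<Rightarrow> ('a \<Rightarrow> int) \<Rightarrow> bool" where
  "power_function G \<phi> \<pi> \<longleftrightarrow>
     (\<forall>x\<in>carrier G. \<forall>y\<in>carrier G.
        \<phi> (x \<otimes>\<^bsub>G\<^esub> y) = \<phi> x \<otimes>\<^bsub>G\<^esub> (\<phi> [^]\<^bsub>BijGroup (carrier G)\<^esub> \<pi> x) y)"

definition skew_morphism :: "('a, 'b) monoid_scheme \<Rightarrow> ('a \<Rightarrow> 'a) \<Rightarrow> bool" where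
  "skew_morphism G \<phi> \<longleftrightarrow>
     group G \<and> finite (carrier G) \<and>
     \<phi> \<in> Bij (carrier G) \<and> \<phi> \<one>\<^bsub>G\<^esub> = \<one>\<^bsub>G\<^esub> \<and> (\<exists>\<pi>. power_function G \<phi> \<pi>)"

definition perm_order :: "('a, 'b) monoid_scheme \<Rightarrow> ('a \<Rightarrow> 'a) \<Rightarrow> nat" where
  "perm_order G \<phi> = group.ord (BijGroup (carrier G)) \<phi>"

(* The elements of integer_mod_group n are the integers 0, ..., n - 1. They serve as the
   representatives when an element of Z_n is used as an exponent of \<phi>; because the order of
   \<phi> divides n, the choice of representatives is immaterial. The element -1 of Z_n is the
   group inverse of 1 mod n (for n = 1 this is 0). *)

definition symmetric_skew_morphism :: "nat \<Rightarrow> (int \<Rightarrow> int) \<Rightarrow> bool" where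
  "symmetric_skew_morphism n \<phi> \<longleftrightarrow>
     (let Z = integer_mod_group n in
        skew_morphism Z \<phi> \<and> perm_order Z \<phi> dvd n \<and>
        power_function Z \<phi>
          (\<lambda>x. inv\<^bsub>Z\<^esub> ((\<phi> [^]\<^bsub>BijGroup (carrier Z)\<^esub> (- x)) (inv\<^bsub>Z\<^esub> (1 mod int n)))))"

definition mult_map :: "nat \<Rightarrow> int \<Rightarrow> int \<Rightarrow> int" where
  "mult_map n r = (\<lambda>x\<in>carrier (integer_mod_group n). (r * x) mod int n)"

lemma mult_map_in_auto:
  assumes "n > 0" and "coprime r (int n)"
  shows "mult_map n r \<in> auto (integer_mod_group n)"
proof -
  let ?Z = "integer_mod_group n"
  have C: "carrier ?Z = {0..<int n}"
    using assms by (simp add: carrier_integer_mod_group)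
  have inj: "inj_on (mult_map n r) (carrier ?Z)"
  proof (rule inj_onI)
    fix x y assume xy: "x \<in> carrier ?Z" "y \<in> carrier ?Z"
      and "mult_map n r x = mult_map n r y"
    then have "[r * x = r * y] (mod int n)"
      by (simp add: mult_map_def cong_def)
    then have "[x = y] (mod int n)"
      using assms by (simp add: cong_mult_lcancel)
    then show "x = y" using xy by (simp add: C cong_def)
  qed
  have sub: "mult_map n r ` carrier ?Z \<subseteq> carrier ?Z"
    using assms by (auto simp: mult_map_def C)
  have "mult_map n r ` carrier ?Z = carrier ?Z"
    by (rule endo_inj_surj[OF _ sub inj]) (simp add: C)
  with inj have "mult_map n r \<in> Bij (carrier ?Z)"
    by (simp add: Bij_def bij_betw_def mult_map_def)
  moreover have "mult_map n r \<in> hom ?Z ?Z"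
  proof (rule homI)
    show "mult_map n r x \<in> carrier ?Z" if "x \<in> carrier ?Z" for x
      using that sub by auto
    show "mult_map n r (x \<otimes>\<^bsub>?Z\<^esub> y) = mult_map n r x \<otimes>\<^bsub>?Z\<^esub> mult_map n r y"
      if "x \<in> carrier ?Z" "y \<in> carrier ?Z" for x y
      using that assms by (simp add: mult_map_def C mod_simps distrib_left)
  qed
  ultimately show ?thesis by (simp add: auto_def)
qed

lemma auto_imp_skew_morphism:
  assumes "group G" "finite (carrier G)" "\<phi> \<in> auto G"
  shows "skew_morphism G \<phi>"
proof -
  interpret B: group "BijGroup (carrier G)" by (rule group_BijGroup)
  have \<phi>: "\<phi> \<in> Bij (carrier G)" "\<phi> \<in> hom G G"
    using assms by (auto simp: auto_def)
  then have "\<phi> [^]\<^bsub>BijGroup (carrier G)\<^esub> (1::int) = \<phi>"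
    by (intro B.int_pow_1) (simp add: BijGroup_def)
  then have "power_function G \<phi> (\<lambda>_. 1)"
    using \<phi> by (simp add: power_function_def hom_mult)
  moreover have "\<phi> \<one>\<^bsub>G\<^esub> = \<one>\<^bsub>G\<^esub>"
    using assms \<phi> hom_one by blast
  ultimately show ?thesis
    using assms \<phi> by (auto simp: skew_morphism_def)
qed

end

theory Submission
  imports Defs
begin

text \<open>For an automorphism \<open>\<phi>\<close> of order \<open>m\<close>, a function \<open>\<pi>\<close> is a power function iff
  \<open>\<phi>\<^bsup>\<pi>(x)\<^esup> = \<phi>\<close> for all \<open>x\<close>, i.e. iff \<open>\<pi>\<close> is constantly \<open>1\<close> modulo \<open>m\<close>. As \<open>\<phi>\<^bsup>-x\<^esup>\<close> is
  additive, the function in the definition of symmetry is \<open>x \<mapsto> \<phi>\<^bsup>-x\<^esup>(1)\<close>, the residue of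
  \<open>r\<^bsup>-x\<^esup>\<close>. It is constantly \<open>1\<close> modulo the divisor \<open>m\<close> of \<open>n\<close> iff \<open>r\<close> is \<open>1\<close> modulo \<open>m\<close>:
  take \<open>x = 1\<close> for one direction, and note that multiplication by \<open>r\<close> then preserves residues
  modulo \<open>m\<close> for the other.\<close>

lemma carrier_BijGroup: "carrier (BijGroup S) = Bij S"
  by (simp add: BijGroup_def)

lemma one_BijGroup_apply: "y \<in> S \<Longrightarrow> \<one>\<^bsub>BijGroup S\<^esub> y = y"
  by (simp add: BijGroup_def)

lemma mult_BijGroup_apply:
  "f \<in> Bij S \<Longrightarrow> g \<in> Bij S \<Longrightarrow> y \<in> S \<Longrightarrow> (f \<otimes>\<^bsub>BijGroup S\<^esub> g) y = f (g y)"
  by (simp add: BijGroup_def compose_eq)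

lemma Bij_apply_closed: "f \<in> Bij S \<Longrightarrow> y \<in> S \<Longrightarrow> f y \<in> S"
  using Bij_imp_funcset by blast

lemma BijGroup_int_pow_in_Bij: "\<phi> \<in> Bij S \<Longrightarrow> \<phi> [^]\<^bsub>BijGroup S\<^esub> (k :: int) \<in> Bij S"
  using group.int_pow_closed[OF group_BijGroup] by (metis carrier_BijGroup)

lemma power_function_auto_iff:
  assumes "group G" "\<phi> \<in> auto G"
  shows "power_function G \<phi> \<pi> \<longleftrightarrow> (\<forall>x\<in>carrier G. [\<pi> x = 1] (mod int (perm_order G \<phi>)))"
proof -
  interpret group G by fact
  let ?B = "BijGroup (carrier G)"
  interpret B: group ?B by (rule group_BijGroup)
  have \<phi>: "\<phi> \<in> carrier ?B" "\<phi> \<in> hom G G"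
    using assms by (auto simp: auto_def carrier_BijGroup)
  have Bij: "\<phi> \<in> Bij (carrier G)" using \<phi>(1) by (simp add: carrier_BijGroup)
  note closed = Bij_apply_closed[OF Bij] Bij_apply_closed[OF BijGroup_int_pow_in_Bij[OF Bij]]
  have pow_eq: "(\<forall>y\<in>carrier G. (\<phi> [^]\<^bsub>?B\<^esub> k) y = \<phi> y) \<longleftrightarrow> [k = 1] (mod int (perm_order G \<phi>))"
    for k :: int
  proof -
    have "(\<forall>y\<in>carrier G. (\<phi> [^]\<^bsub>?B\<^esub> k) y = \<phi> y) \<longleftrightarrow> \<phi> [^]\<^bsub>?B\<^esub> k = \<phi>"
    proof
      assume "\<forall>y\<in>carrier G. (\<phi> [^]\<^bsub>?B\<^esub> k) y = \<phi> y"
      \<comment> \<open>Agreement on the carrier gives equality of functions because members of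
        \<open>Bij\<close> are \<open>undefined\<close> outside it.\<close>
      moreover have "\<phi> \<in> extensional (carrier G)" "\<phi> [^]\<^bsub>?B\<^esub> k \<in> extensional (carrier G)"
        using Bij BijGroup_int_pow_in_Bij[OF Bij] by (simp_all add: Bij_imp_extensional)
      ultimately show "\<phi> [^]\<^bsub>?B\<^esub> k = \<phi>" by (blast intro: extensionalityI)
    qed simp
    also have "\<dots> \<longleftrightarrow> \<phi> [^]\<^bsub>?B\<^esub> k = \<phi> [^]\<^bsub>?B\<^esub> (1::int)"
      using \<phi>(1) by simp
    also have "\<dots> \<longleftrightarrow> [k = 1] (mod int (perm_order G \<phi>))"
      unfolding B.int_pow_eq[OF \<phi>(1)] perm_order_def cong_iff_dvd_diff by (rule dvd_diff_commute)
    finally show ?thesis .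
  qed
  \<comment> \<open>As \<open>\<phi>\<close> is a homomorphism, the left side of the power function
    law is the product of \<open>\<phi> x\<close> and \<open>\<phi> y\<close>; the factor
    \<open>\<phi> x\<close> cancels.\<close>
  have "power_function G \<phi> \<pi> \<longleftrightarrow> (\<forall>x\<in>carrier G. \<forall>y\<in>carrier G. (\<phi> [^]\<^bsub>?B\<^esub> \<pi> x) y = \<phi> y)"
    unfolding power_function_def using \<phi>(2) closed by (auto simp: hom_mult)
  then show ?thesis by (simp add: pow_eq)
qed

text \<open>Automorphisms form a subgroup of \<open>BijGroup\<close>. This makes negative powers
  additive too, so that they commute with inversion.\<close>

lemma auto_int_pow_closed:
  fixes k :: int
  assumes "group G" "\<phi> \<in> auto G"
  shows "\<phi> [^]\<^bsub>BijGroup (carrier G)\<^esub> k \<in> auto G"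
  using group.subgroup_int_pow_closed[OF group_BijGroup group.subgroup_auto] assms by blast

lemma BijGroup_int_pow_minus_apply:
  fixes k :: int
  assumes "\<phi> \<in> Bij S" "y \<in> S"
  shows "(\<phi> [^]\<^bsub>BijGroup S\<^esub> k) ((\<phi> [^]\<^bsub>BijGroup S\<^esub> (- k)) y) = y"
proof -
  interpret B: group "BijGroup S" by (rule group_BijGroup)
  have \<phi>: "\<phi> \<in> carrier (BijGroup S)" using assms by (simp add: carrier_BijGroup)
  have "\<phi> [^]\<^bsub>BijGroup S\<^esub> k \<otimes>\<^bsub>BijGroup S\<^esub> \<phi> [^]\<^bsub>BijGroup S\<^esub> (- k) = \<one>\<^bsub>BijGroup S\<^esub>"
    using B.int_pow_mult[OF \<phi>, of k "- k"] by simp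
  then show ?thesis
    using mult_BijGroup_apply[of "\<phi> [^]\<^bsub>BijGroup S\<^esub> k" S "\<phi> [^]\<^bsub>BijGroup S\<^esub> (- k)" y]
      BijGroup_int_pow_in_Bij[OF assms(1)] one_BijGroup_apply assms(2) by metis
qed

text \<open>An invariant of \<open>\<phi>\<close> is constant on its orbits. It will be applied with
  the residue modulo \<open>m\<close> as \<open>f\<close>.\<close>

lemma BijGroup_int_pow_preserves:
  fixes f :: "'a \<Rightarrow> 'b" and k :: int
  assumes "\<phi> \<in> Bij S" and f: "\<And>y. y \<in> S \<Longrightarrow> f (\<phi> y) = f y" and "y \<in> S"
  shows "f ((\<phi> [^]\<^bsub>BijGroup S\<^esub> k) y) = f y"
proof -
  interpret B: group "BijGroup S" by (rule group_BijGroup)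
  have \<phi>: "\<phi> \<in> carrier (BijGroup S)" using assms by (simp add: carrier_BijGroup)
  have nat: "f ((\<phi> [^]\<^bsub>BijGroup S\<^esub> j) z) = f z" if "z \<in> S" for j :: nat and z
    using that
  \<comment> \<open>The power \<open>Suc j\<close> applies \<open>\<phi>\<close> first, so the
    induction hypothesis is needed at \<open>\<phi> z\<close>.\<close>
  proof (induction j arbitrary: z)
    case 0
    then show ?case by (simp add: one_BijGroup_apply)
  next
    case (Suc j)
    have "\<phi> [^]\<^bsub>BijGroup S\<^esub> j \<in> Bij S"
      using B.nat_pow_closed[OF \<phi>] by (simp add: carrier_BijGroup)
    with Suc show ?case
      using assms(1) by (simp add: mult_BijGroup_apply Bij_apply_closed f)
  qed
  show ?thesis
  proof (cases "k \<ge> 0")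
    case True
    then show ?thesis using nat[OF assms(3), of "nat k"] by (simp flip: int_pow_int)
  next
    case False
    \<comment> \<open>For negative \<open>k\<close>, the case of natural exponents applies to
      \<open>- k\<close> at the point \<open>?z\<close>, which that power sends back to
      \<open>y\<close>.\<close>
    let ?z = "(\<phi> [^]\<^bsub>BijGroup S\<^esub> k) y"
    have "?z \<in> S" by (rule Bij_apply_closed[OF BijGroup_int_pow_in_Bij[OF assms(1)] assms(3)])
    then have "f ((\<phi> [^]\<^bsub>BijGroup S\<^esub> (- k)) ?z) = f ?z"
      using False nat[of ?z "nat (- k)"] by (simp flip: int_pow_int)
    then show ?thesis
      using BijGroup_int_pow_minus_apply[OF assms(1,3), of "- k"] by simp
  qed
qed

theorem theorem5:
  fixes n m :: nat and r :: int and \<phi> :: "int \<Rightarrow> int"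
  assumes "n > 0"
    and "coprime r (int n)"
    and "\<phi> = mult_map n r"
    and "m = perm_order (integer_mod_group n) \<phi>"
  shows "symmetric_skew_morphism n \<phi> \<longleftrightarrow> m dvd n \<and> [r = 1] (mod int m)"
proof -
  let ?Z = "integer_mod_group n"
  let ?B = "BijGroup (carrier ?Z)"
  interpret Z: group ?Z by simp
  interpret B: group ?B by (rule group_BijGroup)
  have C: "carrier ?Z = {0..<int n}" and one: "1 mod int n \<in> carrier ?Z"
    using assms(1) by (simp_all add: carrier_integer_mod_group)
  have auto: "\<phi> \<in> auto ?Z" using mult_map_in_auto assms by simp
  then have bij: "\<phi> \<in> Bij (carrier ?Z)" by (simp add: auto_def)
  have skew: "skew_morphism ?Z \<phi>"
    using auto by (intro auto_imp_skew_morphism) (simp_all add: C)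
  \<comment> \<open>The two inversions in the definition of symmetry cancel, since each power of
    \<open>\<phi>\<close> is a homomorphism.\<close>
  have pow_inv: "inv\<^bsub>?Z\<^esub> ((\<phi> [^]\<^bsub>?B\<^esub> k) (inv\<^bsub>?Z\<^esub> (1 mod int n))) = (\<phi> [^]\<^bsub>?B\<^esub> k) (1 mod int n)"
    for k :: int
  proof -
    have hom: "\<phi> [^]\<^bsub>?B\<^esub> k \<in> hom ?Z ?Z"
      using auto_int_pow_closed[OF _ auto] by (simp add: auto_def)
    interpret group_hom ?Z ?Z "\<phi> [^]\<^bsub>?B\<^esub> k"
      using hom by unfold_locales
    show ?thesis
      by (simp only: hom_inv[OF one] Z.inv_inv[OF hom_closed[OF one]])
  qed
  have "(\<forall>x\<in>carrier ?Z. [(\<phi> [^]\<^bsub>?B\<^esub> (- x)) (1 mod int n) = 1] (mod int m)) \<longleftrightarrow> [r = 1] (mod int m)"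
    (is "?L \<longleftrightarrow> ?R") if "m dvd n"
  proof
    \<comment> \<open>Since \<open>m\<close> divides \<open>n\<close>, reduction modulo
      \<open>n\<close> does not change residues modulo \<open>m\<close>.\<close>
    have cong_m: "[a mod int n = a] (mod int m)" for a
      using that by (simp add: cong_def mod_mod_cancel)
    have app: "[\<phi> y = r * y] (mod int m)" if "y \<in> carrier ?Z" for y
      using that cong_m assms(3) by (simp add: mult_map_def)
    show ?R if L: ?L
    \<comment> \<open>For \<open>n = 1\<close> the carrier is {0}, so \<open>?L\<close> cannot be
      used at 1; but then \<open>m = 1\<close> and the congruence is trivial.\<close>
    proof (cases "n = 1")
      case True
      with \<open>m dvd n\<close> show ?thesis by simp
    next
      case False
      with assms(1) have "1 \<in> carrier ?Z" by (simp add: C)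
      \<comment> \<open>\<open>s\<close> represents the inverse of \<open>r\<close> modulo
        \<open>n\<close>. It is 1 modulo \<open>m\<close> by \<open>?L\<close> at 1, which forces
        the same for \<open>r\<close>.\<close>
      define s where "s = (\<phi> [^]\<^bsub>?B\<^esub> (- 1 :: int)) (1 mod int n)"
      have s: "s \<in> carrier ?Z" "[s = 1] (mod int m)"
        using Bij_apply_closed[OF BijGroup_int_pow_in_Bij[OF bij] one] L \<open>1 \<in> carrier ?Z\<close>
        unfolding s_def by blast+
      have "\<phi> s = 1 mod int n"
        using BijGroup_int_pow_minus_apply[OF bij one, of 1] bij by (simp add: s_def carrier_BijGroup)
      then have "[r * s = 1] (mod int m)"
        using app[OF s(1)] cong_m[of 1] by (simp add: cong_def)
      moreover have "[r * s = r * 1] (mod int m)"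
        using s(2) by (rule cong_scalar_left)
      ultimately show ?thesis by (simp add: cong_def)
    qed
    show ?L if R: ?R
    proof
      fix x :: int
      \<comment> \<open>The residue modulo \<open>m\<close> is an invariant of
        \<open>\<phi>\<close>, hence of all its powers.\<close>
      have "\<phi> y mod int m = y mod int m" if "y \<in> carrier ?Z" for y
        using app[OF that] cong_scalar_right[OF R, of y] by (simp add: cong_def)
      then have "(\<phi> [^]\<^bsub>?B\<^esub> (- x)) (1 mod int n) mod int m = 1 mod int n mod int m"
        using one by (rule BijGroup_int_pow_preserves[OF bij, where f = "\<lambda>y. y mod int m" and k = "- x"])
      also have "\<dots> = 1 mod int m" using cong_m[of 1] by (simp add: cong_def)
      finally show "[(\<phi> [^]\<^bsub>?B\<^esub> (- x)) (1 mod int n) = 1] (mod int m)"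
        by (simp add: cong_def)
    qed
  qed
  moreover have "symmetric_skew_morphism n \<phi> \<longleftrightarrow> m dvd n \<and>
      (\<forall>x\<in>carrier ?Z. [(\<phi> [^]\<^bsub>?B\<^esub> (- x)) (1 mod int n) = 1] (mod int m))"
    using skew by (simp add: symmetric_skew_morphism_def Let_def pow_inv assms(4)
        power_function_auto_iff[OF _ auto])
  ultimately show ?thesis by blast
qed

end
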